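(* Let $d(n)$ denote the number of maximal independent sets of the diamond cactus $D(n)$. Then $d(1)=2$, $d(2)=4$, $d(3)=7$, and $d(n)=2d(n-1)-d(n-2)+d(n-3)$ for all $n\ge 4$.
   Context: For $n\ge 1$, the diamond (meta-rectangular) cactus $D(n)$ is the graph formed by a chain of $n$ 4-cycles $B_1,\dots,B_n$, where for each $1\le i\le n-1$ the consecutive cycles $B_i$ and $B_{i+1}$ share exactly one vertex, non-consecutive cycles share no vertex, every vertex lies in at most two cycles, and for each $2\le i\le n-1$ the two shared (cut) vertices of $B_i$ are at distance two in $B_i$ (i.e. opposite vertices of the 4-cycle). An independent set is maximal if no further vertex can be added while keeping it independent. *)

theory Defs
  imports Main "HOL-Library.Ramsey"
begin

text \<open>A simple graph is given by its vertex set and its set of edges, each edge being a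
  two-element set of vertices; \<open>indep\<close> is the independence predicate of
  \<^theory>\<open>HOL-Library.Ramsey\<close>.\<close>

definition maximal_independent :: "'a set \<Rightarrow> 'a set set \<Rightarrow> 'a set \<Rightarrow> bool" where
  "maximal_independent V E S \<longleftrightarrow>
     S \<subseteq> V \<and> indep S E \<and> (\<forall>v\<in>V - S. \<not> indep (insert v S) E)"

definition num_maximal_independent :: "'a set \<Rightarrow> 'a set set \<Rightarrow> nat" where
  "num_maximal_independent V E = card {S. maximal_independent V E S}"

definition four_cycle :: "'a set \<Rightarrow> 'a set set \<Rightarrow> bool" where
  "four_cycle V E \<longleftrightarrow>
     (\<exists>a b c d. distinct [a, b, c, d] \<and> V = {a, b, c, d} \<and>
        E = {{a, b}, {b, c}, {c, d}, {d, a}})"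

definition at_distance_two :: "'a set \<Rightarrow> 'a set set \<Rightarrow> 'a \<Rightarrow> 'a \<Rightarrow> bool" where
  "at_distance_two V E x y \<longleftrightarrow>
     x \<noteq> y \<and> {x, y} \<notin> E \<and> (\<exists>z\<in>V. {x, z} \<in> E \<and> {z, y} \<in> E)"

text \<open>The \<open>i\<close>-th cycle of the chain has vertex set \<open>W i\<close> and edge set \<open>F i\<close>. The description
  determines the graph up to isomorphism.\<close>

definition diamond_cactus :: "nat \<Rightarrow> 'a set \<Rightarrow> 'a set set \<Rightarrow> bool" where
  "diamond_cactus n V E \<longleftrightarrow> n \<ge> 1 \<and>
     (\<exists>W F. (\<forall>i\<in>{1..n}. four_cycle (W i) (F i)) \<and>
        V = (\<Union>i\<in>{1..n}. W i) \<and> E = (\<Union>i\<in>{1..n}. F i) \<and>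
        (\<forall>i. 1 \<le> i \<and> i \<le> n - 1 \<longrightarrow> card (W i \<inter> W (i + 1)) = 1) \<and>
        (\<forall>i\<in>{1..n}. \<forall>j\<in>{1..n}. i + 1 < j \<longrightarrow> W i \<inter> W j = {}) \<and>
        (\<forall>v\<in>V. card {i\<in>{1..n}. v \<in> W i} \<le> 2) \<and>
        (\<forall>i. 2 \<le> i \<and> i \<le> n - 1 \<longrightarrow>
           (\<forall>x\<in>W (i - 1) \<inter> W i. \<forall>y\<in>W i \<inter> W (i + 1). at_distance_two (W i) (F i) x y)))"

text \<open>Existence: the cut vertices of the chain are multiples of 3.\<close>

lemma diamond_cactus_exists:
  assumes "n \<ge> 1"
  shows "\<exists>(V :: nat set) E. diamond_cactus n V E"
proof -
  define W :: "nat \<Rightarrow> nat set" where "W i = {3*i, 3*i+1, 3*i+3, 3*i+2}" for i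
  define F :: "nat \<Rightarrow> nat set set" where
    "F i = {{3*i, 3*i+1}, {3*i+1, 3*i+3}, {3*i+3, 3*i+2}, {3*i+2, 3*i}}" for i
  have cyc: "four_cycle (W i) (F i)" for i
    unfolding four_cycle_def
    by (rule exI[of _ "3*i"], rule exI[of _ "3*i+1"], rule exI[of _ "3*i+3"],
        rule exI[of _ "3*i+2"]) (simp add: W_def F_def)
  have inter: "W i \<inter> W (i + 1) = {3*i+3}" for i
    by (auto simp: W_def)
  have disj: "W i \<inter> W j = {}" if "i + 1 < j" for i j
    using that by (auto simp: W_def)
  have two: "card {i\<in>{1..n}. v \<in> W i} \<le> 2" for v
  proof -
    have "{i\<in>{1..n}. v \<in> W i} \<subseteq> {v div 3 - 1, v div 3}"
      by (auto simp: W_def)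
    then have "card {i\<in>{1..n}. v \<in> W i} \<le> card {v div 3 - 1, v div 3}"
      by (intro card_mono) auto
    also have "\<dots> \<le> 2"
      by (simp add: card_insert_if)
    finally show ?thesis .
  qed
  have opp: "at_distance_two (W i) (F i) x y"
    if i: "2 \<le> i" and x: "x \<in> W (i - 1) \<inter> W i" and y: "y \<in> W i \<inter> W (i + 1)" for i x y
  proof -
    have "x = 3*i" using inter[of "i - 1"] i x by auto
    moreover have "y = 3*i+3" using inter[of i] y by auto
    ultimately show ?thesis
      unfolding at_distance_two_def W_def F_def by (auto simp: doubleton_eq_iff)
  qed
  have "diamond_cactus n (\<Union>i\<in>{1..n}. W i) (\<Union>i\<in>{1..n}. F i)"
    unfolding diamond_cactus_def
    by (intro conjI exI[of _ W] exI[of _ F]) (use assms cyc inter disj two opp in auto)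
  then show ?thesis by blast
qed

end

theory Submission
  imports Defs
begin

text \<open>Label the cut vertices \<open>c\<^sub>0, \<dots>, c\<^sub>n\<close>, where \<open>c\<^sub>0\<close> and \<open>c\<^sub>n\<close> are the vertices of the two
  end cycles opposite to their cut vertices. The other two vertices of the cycle through
  \<open>c\<^sub>i\<close> and \<open>c\<^sub>i\<^sub>+\<^sub>1\<close> have exactly these two neighbours, so they belong to a maximal
  independent set iff neither \<open>c\<^sub>i\<close> nor \<open>c\<^sub>i\<^sub>+\<^sub>1\<close> does. Hence a maximal independent set is
  determined by its trace on the \<open>c\<^sub>i\<close>, and the traces that occur are the binary words of
  length \<open>n + 1\<close> in which every run of zeros has length at least two. The recurrence is that
  of these words.\<close>

section \<open>Binary words without isolated zeros\<close>

text \<open>The first argument tells whether the letter preceding the word is a zero, that is,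
  \<^const>\<open>False\<close>.\<close>

primrec no_isolated :: "bool \<Rightarrow> bool list \<Rightarrow> bool" where
  "no_isolated z [] = True"
| "no_isolated z (x # xs) =
     (if x then no_isolated False xs
      else (z \<or> xs \<noteq> [] \<and> \<not> hd xs) \<and> no_isolated True xs)"

lemma no_isolated_nth:
  "no_isolated z xs \<longleftrightarrow>
     (\<forall>j<length xs. \<not> xs ! j \<longrightarrow>
        (if j = 0 then z else \<not> xs ! (j - 1)) \<or> (Suc j < length xs \<and> \<not> xs ! Suc j))"
proof (induction xs arbitrary: z)
  case (Cons x xs)
  have shift: "(\<forall>j<length (x # xs). P j) \<longleftrightarrow> P 0 \<and> (\<forall>j<length xs. P (Suc j))" for P
    by (auto simp: less_Suc_eq_0_disj)
  show ?case
    unfolding shift no_isolated.simps Cons.IH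
    by (cases x; cases xs) (auto simp: nth_Cons split: nat.splits)
qed simp

definition num_words :: "bool \<Rightarrow> nat \<Rightarrow> nat" where
  "num_words z m = card {xs. length xs = m \<and> no_isolated z xs}"

lemma finite_words: "finite {xs :: bool list. length xs = m \<and> P xs}"
  by (rule finite_subset[OF _ finite_lists_length_eq[of "UNIV :: bool set" m]]) auto

lemma card_words_Suc:
  "card {xs :: bool list. length xs = Suc m \<and> P xs} =
     card {xs. length xs = m \<and> P (True # xs)} + card {xs. length xs = m \<and> P (False # xs)}"
proof -
  have "{xs. length xs = Suc m \<and> P xs} =
      (#) True ` {xs. length xs = m \<and> P (True # xs)} \<union>
      (#) False ` {xs. length xs = m \<and> P (False # xs)}" (is "_ = ?A \<union> ?B")
    by (auto simp: length_Suc_conv image_iff) (metis (full_types))+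
  moreover have "card (?A \<union> ?B) = card ?A + card ?B"
    by (intro card_Un_disjoint finite_imageI finite_words) auto
  ultimately show ?thesis
    by (simp add: card_image)
qed

lemma num_words_0 [simp]: "num_words z 0 = 1"
proof -
  have "{xs. length xs = 0 \<and> no_isolated z xs} = {[]}" by auto
  then show ?thesis by (simp add: num_words_def)
qed

lemma num_words_False_1: "num_words False (Suc 0) = 1"
  using num_words_0[of False]
  unfolding num_words_def card_words_Suc by (simp cong: conj_cong)

lemma num_words_False_Suc_Suc:
  "num_words False (Suc (Suc m)) = num_words False (Suc m) + num_words True m"
proof -
  have "card {xs. length xs = Suc m \<and> no_isolated False (False # xs)} = num_words True m"
    unfolding num_words_def card_words_Suc by simp
  moreover have "card {xs. length xs = Suc m \<and> no_isolated False (True # xs)} =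
      num_words False (Suc m)"
    by (simp add: num_words_def)
  ultimately show ?thesis
    unfolding num_words_def[of False "Suc (Suc m)"] card_words_Suc[of "Suc m"] by simp
qed

lemma num_words_True_Suc: "num_words True (Suc m) = num_words False m + num_words True m"
  unfolding num_words_def card_words_Suc by simp

lemma num_words_recurrence:
  "num_words False (m + 4) + num_words False (m + 2) =
     2 * num_words False (m + 3) + num_words False (m + 1)"
  using num_words_False_Suc_Suc[of "Suc (Suc m)"] num_words_False_Suc_Suc[of "Suc m"]
    num_words_True_Suc[of "Suc m"]
  by (simp add: eval_nat_numeral)

section \<open>Maximal independent sets of a labelled chain\<close>

lemma maximal_independent_iff:
  assumes "\<And>v. {v} \<notin> E"
  shows "maximal_independent V E S \<longleftrightarrow>
    S \<subseteq> V \<and> (\<forall>v\<in>V. v \<in> S \<longleftrightarrow> (\<forall>u\<in>S. {v, u} \<notin> E))"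
  using assms unfolding maximal_independent_def indep_def
  by (smt (verit) DiffD1 DiffD2 DiffI doubleton_eq_iff insert_absorb2 insert_commute insert_iff subset_iff)

locale diamond_chain =
  fixes n :: nat and c p q :: "nat \<Rightarrow> 'a"
  assumes c_eq_iff: "i \<le> n \<Longrightarrow> j \<le> n \<Longrightarrow> c i = c j \<longleftrightarrow> i = j"
    and p_eq_iff: "i < n \<Longrightarrow> j < n \<Longrightarrow> p i = p j \<longleftrightarrow> i = j"
    and q_eq_iff: "i < n \<Longrightarrow> j < n \<Longrightarrow> q i = q j \<longleftrightarrow> i = j"
    and p_neq_q: "i < n \<Longrightarrow> j < n \<Longrightarrow> p i \<noteq> q j"
    and p_neq_c: "i < n \<Longrightarrow> j \<le> n \<Longrightarrow> p i \<noteq> c j"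
    and q_neq_c: "i < n \<Longrightarrow> j \<le> n \<Longrightarrow> q i \<noteq> c j"
begin

definition verts :: "'a set" where
  "verts = c ` {..n} \<union> p ` {..<n} \<union> q ` {..<n}"

definition edges :: "'a set set" where
  "edges = (\<Union>i<n. {{c i, p i}, {p i, c (Suc i)}, {c (Suc i), q i}, {q i, c i}})"

lemmas label_neqs = p_neq_q p_neq_q[symmetric] p_neq_c p_neq_c[symmetric] q_neq_c q_neq_c[symmetric]

lemma no_loop: "{v} \<notin> edges"
  using label_neqs unfolding edges_def
  by auto

lemma edge_p_iff:
  assumes "i < n" shows "{p i, v} \<in> edges \<longleftrightarrow> v = c i \<or> v = c (Suc i)"
  using assms unfolding edges_def
  by (auto simp: doubleton_eq_iff label_neqs p_eq_iff)

lemma edge_q_iff: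
  assumes "i < n" shows "{q i, v} \<in> edges \<longleftrightarrow> v = c i \<or> v = c (Suc i)"
  using assms unfolding edges_def
  by (auto simp: doubleton_eq_iff label_neqs q_eq_iff)

lemma edge_c_iff:
  assumes "j \<le> n"
  shows "{c j, v} \<in> edges \<longleftrightarrow> (\<exists>i<n. (j = i \<or> j = Suc i) \<and> (v = p i \<or> v = q i))"
  using assms unfolding edges_def
  by (auto simp: doubleton_eq_iff label_neqs c_eq_iff)

lemma maximal_independent_chain_iff:
  "maximal_independent verts edges S \<longleftrightarrow> S \<subseteq> verts \<and>
     (\<forall>i<n. (p i \<in> S \<longleftrightarrow> c i \<notin> S \<and> c (Suc i) \<notin> S) \<and> (q i \<in> S \<longleftrightarrow> c i \<notin> S \<and> c (Suc i) \<notin> S)) \<and>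
     (\<forall>j\<le>n. c j \<notin> S \<longrightarrow> (\<exists>i<n. (j = i \<or> j = Suc i) \<and> c i \<notin> S \<and> c (Suc i) \<notin> S))"
    (is "_ \<longleftrightarrow> S \<subseteq> verts \<and> ?PQ \<and> ?C")
proof -
  have "maximal_independent verts edges S \<longleftrightarrow>
      S \<subseteq> verts \<and> (\<forall>v\<in>verts. v \<in> S \<longleftrightarrow> (\<forall>u\<in>S. {v, u} \<notin> edges))"
    by (rule maximal_independent_iff[OF no_loop])
  also have "(\<forall>v\<in>verts. v \<in> S \<longleftrightarrow> (\<forall>u\<in>S. {v, u} \<notin> edges)) \<longleftrightarrow>
      (\<forall>i<n. (p i \<in> S \<longleftrightarrow> (\<forall>u\<in>S. {p i, u} \<notin> edges)) \<and> (q i \<in> S \<longleftrightarrow> (\<forall>u\<in>S. {q i, u} \<notin> edges))) \<and>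
      (\<forall>j\<le>n. c j \<in> S \<longleftrightarrow> (\<forall>u\<in>S. {c j, u} \<notin> edges))"
    unfolding verts_def by blast
  also have "\<dots> \<longleftrightarrow> ?PQ \<and> (\<forall>j\<le>n. c j \<in> S \<longleftrightarrow> (\<forall>u\<in>S. {c j, u} \<notin> edges))"
    by (auto simp: edge_p_iff edge_q_iff)
  also have "\<dots> \<longleftrightarrow> ?PQ \<and> ?C"
  proof (rule conj_cong[OF refl])
    assume PQ: ?PQ
    have "(c j \<in> S \<longleftrightarrow> (\<forall>u\<in>S. {c j, u} \<notin> edges)) \<longleftrightarrow>
        (c j \<notin> S \<longrightarrow> (\<exists>i<n. (j = i \<or> j = Suc i) \<and> c i \<notin> S \<and> c (Suc i) \<notin> S))" if "j \<le> n" for j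
      unfolding edge_c_iff[OF that] using PQ by blast
    then show "(\<forall>j\<le>n. c j \<in> S \<longleftrightarrow> (\<forall>u\<in>S. {c j, u} \<notin> edges)) \<longleftrightarrow> ?C"
      by blast
  qed
  finally show ?thesis .
qed

definition trace :: "'a set \<Rightarrow> bool list" where
  "trace S = map (\<lambda>j. c j \<in> S) [0..<Suc n]"

lemma length_trace [simp]: "length (trace S) = Suc n"
  by (simp add: trace_def)

lemma trace_nth [simp]: "j \<le> n \<Longrightarrow> trace S ! j \<longleftrightarrow> c j \<in> S"
  unfolding trace_def by (subst nth_map) (simp_all del: upt_Suc)

lemma no_isolated_trace_iff:
  "no_isolated False (trace S) \<longleftrightarrow>
     (\<forall>j\<le>n. c j \<notin> S \<longrightarrow> (\<exists>i<n. (j = i \<or> j = Suc i) \<and> c i \<notin> S \<and> c (Suc i) \<notin> S))"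
proof -
  have "(if j = 0 then False else \<not> trace S ! (j - 1)) \<or> (Suc j < length (trace S) \<and> \<not> trace S ! Suc j)
     \<longleftrightarrow> (\<exists>i<n. (j = i \<or> j = Suc i) \<and> c i \<notin> S \<and> c (Suc i) \<notin> S)" if "j \<le> n" "c j \<notin> S" for j
    using that by (cases j) (auto simp: Suc_le_eq)
  then show ?thesis
    unfolding no_isolated_nth by (auto simp: less_Suc_eq_le)
qed

lemma num_maximal_independent_chain:
  "num_maximal_independent verts edges = num_words False (Suc n)"
proof -
  have "bij_betw trace {S. maximal_independent verts edges S}
      {xs. length xs = Suc n \<and> no_isolated False xs}"
    unfolding bij_betw_def
  proof (rule conjI, rule inj_onI, rule_tac [2] equalityI, rule_tac [2-3] subsetI)
    fix S T
    assume "S \<in> {S. maximal_independent verts edges S}" "T \<in> {S. maximal_independent verts edges S}"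
      and eq: "trace S = trace T"
    then have S: "maximal_independent verts edges S" and T: "maximal_independent verts edges T"
      by auto
    have c: "c j \<in> S \<longleftrightarrow> c j \<in> T" if "j \<le> n" for j
      using arg_cong[OF eq, of "\<lambda>xs. xs ! j"] that by simp
    have "v \<in> S \<longleftrightarrow> v \<in> T" if "v \<in> verts" for v
      using that c S[unfolded maximal_independent_chain_iff] T[unfolded maximal_independent_chain_iff]
      by (auto simp: verts_def Suc_le_eq)
    then show "S = T"
      using S T unfolding maximal_independent_def by blast
  next
    fix xs assume "xs \<in> trace ` {S. maximal_independent verts edges S}"
    then show "xs \<in> {xs. length xs = Suc n \<and> no_isolated False xs}"
      by (auto simp: maximal_independent_chain_iff no_isolated_trace_iff)
  next
    fix xs assume "xs \<in> {xs. length xs = Suc n \<and> no_isolated False xs}"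
    then have len: "length xs = Suc n" and ok: "no_isolated False xs"
      by auto
    define I where "I = {i. i < n \<and> \<not> xs ! i \<and> \<not> xs ! Suc i}"
    define S where "S = c ` {j. j \<le> n \<and> xs ! j} \<union> p ` I \<union> q ` I"
    have c: "c j \<in> S \<longleftrightarrow> xs ! j" if "j \<le> n" for j
      using that by (auto simp: S_def I_def c_eq_iff label_neqs)
    have p: "p i \<in> S \<longleftrightarrow> i \<in> I" if "i < n" for i
      using that by (auto simp: S_def I_def p_eq_iff label_neqs)
    have q: "q i \<in> S \<longleftrightarrow> i \<in> I" if "i < n" for i
      using that by (auto simp: S_def I_def q_eq_iff label_neqs)
    have tr: "trace S = xs"
      by (rule nth_equalityI) (auto simp: len c less_Suc_eq_le)
    have "S \<subseteq> verts"
      by (auto simp: S_def I_def verts_def)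
    then have "maximal_independent verts edges S"
      unfolding maximal_independent_chain_iff no_isolated_trace_iff[symmetric]
      using ok by (auto simp: tr p q c I_def)
    with tr show "xs \<in> trace ` {S. maximal_independent verts edges S}"
      by blast
  qed
  then show ?thesis
    unfolding num_maximal_independent_def num_words_def by (rule bij_betw_same_card)
qed

end

section \<open>Labelling a diamond cactus\<close>

definition opposite :: "'a set \<Rightarrow> 'a set set \<Rightarrow> 'a \<Rightarrow> 'a \<Rightarrow> bool" where
  "opposite W F x y \<longleftrightarrow> (\<exists>p q. distinct [x, p, y, q] \<and> W = {x, p, y, q} \<and>
     F = {{x, p}, {p, y}, {y, q}, {q, x}})"

lemma opposite_sym: "opposite W F x y \<Longrightarrow> opposite W F y x"
  unfolding opposite_def by (elim exE, rename_tac p q, rule_tac x = q in exI, rule_tac x = p in exI) auto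

lemma four_cycle_opposite:
  assumes "four_cycle W F" "x \<in> W"
  obtains y where "opposite W F x y"
proof -
  obtain a b c d where W: "distinct [a, b, c, d]" "W = {a, b, c, d}"
    and F: "F = {{a, b}, {b, c}, {c, d}, {d, a}}"
    using assms(1) unfolding four_cycle_def by blast
  have ac: "opposite W F a c"
    unfolding opposite_def using W F by blast
  have bd: "opposite W F b d"
    unfolding opposite_def
    by (rule exI[of _ c], rule exI[of _ a]) (use W F in auto)
  have "x = a \<or> x = b \<or> x = c \<or> x = d"
    using assms(2) W by simp
  then show ?thesis
    using that ac bd ac[THEN opposite_sym] bd[THEN opposite_sym] by metis
qed

lemma at_distance_two_opposite:
  assumes "four_cycle W F" "x \<in> W" "y \<in> W" "at_distance_two W F x y"
  shows "opposite W F x y"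
proof -
  obtain y' where y': "opposite W F x y'"
    using four_cycle_opposite[OF assms(1,2)] by metis
  then have "y = y'"
    using assms(3,4) unfolding opposite_def at_distance_two_def by (auto simp: insert_commute)
  with y' show ?thesis by simp
qed

lemma diamond_cactus_cut_vertices:
  assumes cyc: "\<And>i. 1 \<le> i \<Longrightarrow> i \<le> n \<Longrightarrow> four_cycle (W i) (F i)"
    and one: "\<And>i. 1 \<le> i \<Longrightarrow> i \<le> n - 1 \<Longrightarrow> card (W i \<inter> W (i + 1)) = 1"
    and dist: "\<And>i x y. 2 \<le> i \<Longrightarrow> i \<le> n - 1 \<Longrightarrow> x \<in> W (i - 1) \<inter> W i \<Longrightarrow> y \<in> W i \<inter> W (i + 1) \<Longrightarrow>
      at_distance_two (W i) (F i) x y"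
    and n: "n \<ge> 1"
  obtains c where "\<And>i. i < n \<Longrightarrow> opposite (W (Suc i)) (F (Suc i)) (c i) (c (Suc i))"
    and "\<And>i. 1 \<le> i \<Longrightarrow> i < n \<Longrightarrow> W i \<inter> W (Suc i) = {c i}"
proof (cases "n = 1")
  case True
  obtain a b where "opposite (W 1) (F 1) a b"
    using cyc[of 1] n four_cycle_opposite unfolding four_cycle_def
    by (metis insertI1 le_refl)
  then show ?thesis
    using that[of "\<lambda>i. if i = 0 then a else b"] True by auto
next
  case False
  with n have n2: "n \<ge> 2" by simp
  have "\<forall>i. \<exists>x. 1 \<le> i \<and> i < n \<longrightarrow> W i \<inter> W (Suc i) = {x}"
    using one by (metis Suc_eq_plus1 card_1_singletonE less_eq_Suc_le Suc_le_D diff_Suc_1 Suc_le_mono)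
  then obtain s where s: "\<And>i. 1 \<le> i \<Longrightarrow> i < n \<Longrightarrow> W i \<inter> W (Suc i) = {s i}"
    by metis
  have "s 1 \<in> W 1" using s[of 1] n2 by auto
  with cyc[of 1] n obtain a where a: "opposite (W 1) (F 1) (s 1) a"
    by (auto elim: four_cycle_opposite)
  have "s (n - 1) \<in> W n" using s[of "n - 1"] n2 by fastforce
  with cyc[of n] n obtain b where b: "opposite (W n) (F n) (s (n - 1)) b"
    by (auto elim: four_cycle_opposite)
  define c where "c = (\<lambda>i. if i = 0 then a else if i = n then b else s i)"
  show ?thesis
  proof (rule that)
    show "W i \<inter> W (Suc i) = {c i}" if "1 \<le> i" "i < n" for i
      using s that by (simp add: c_def)
    show "opposite (W (Suc i)) (F (Suc i)) (c i) (c (Suc i))" if "i < n" for i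
    proof -
      consider "i = 0" | "Suc i = n" "i \<noteq> 0" | "1 \<le> i" "Suc i < n"
        using \<open>i < n\<close> by linarith
      then show ?thesis
      proof cases
        case 1
        then show ?thesis using a n2 by (auto simp: c_def intro: opposite_sym)
      next
        case 2
        then show ?thesis using b by (auto simp: c_def)
      next
        case 3
        have x: "s i \<in> W i \<inter> W (Suc i)" and y: "s (Suc i) \<in> W (Suc i) \<inter> W (Suc (Suc i))"
          using s[of i] s[of "Suc i"] 3 by auto
        have "at_distance_two (W (Suc i)) (F (Suc i)) (s i) (s (Suc i))"
          using dist[of "Suc i"] x y 3 by auto
        then show ?thesis
          using at_distance_two_opposite cyc[of "Suc i"] x y 3 by (auto simp: c_def)
      qed
    qed
  qed
qed

lemma diamond_cactus_labelling:
  assumes "diamond_cactus n V E"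
  obtains c p q where "diamond_chain n c p q"
    and "V = diamond_chain.verts n c p q" and "E = diamond_chain.edges n c p q"
proof -
  obtain W F where n: "n \<ge> 1"
    and cyc': "\<forall>i\<in>{1..n}. four_cycle (W i) (F i)"
    and V: "V = (\<Union>i\<in>{1..n}. W i)" and E: "E = (\<Union>i\<in>{1..n}. F i)"
    and one': "\<forall>i. 1 \<le> i \<and> i \<le> n - 1 \<longrightarrow> card (W i \<inter> W (i + 1)) = 1"
    and disj: "\<forall>i\<in>{1..n}. \<forall>j\<in>{1..n}. i + 1 < j \<longrightarrow> W i \<inter> W j = {}"
    and dist': "\<forall>i. 2 \<le> i \<and> i \<le> n - 1 \<longrightarrow>
      (\<forall>x\<in>W (i - 1) \<inter> W i. \<forall>y\<in>W i \<inter> W (i + 1). at_distance_two (W i) (F i) x y)"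
    using assms unfolding diamond_cactus_def by (elim conjE exE) (rule that)
  have cyc: "four_cycle (W i) (F i)" if "1 \<le> i" "i \<le> n" for i
    using cyc' that by simp
  have one: "card (W i \<inter> W (i + 1)) = 1" if "1 \<le> i" "i \<le> n - 1" for i
    using one' that by blast
  have dist: "at_distance_two (W i) (F i) x y"
    if "2 \<le> i" "i \<le> n - 1" "x \<in> W (i - 1) \<inter> W i" "y \<in> W i \<inter> W (i + 1)" for i x y
    using dist' that by blast
  obtain c where opp: "\<And>i. i < n \<Longrightarrow> opposite (W (Suc i)) (F (Suc i)) (c i) (c (Suc i))"
    and cut: "\<And>i. 1 \<le> i \<Longrightarrow> i < n \<Longrightarrow> W i \<inter> W (Suc i) = {c i}"
    using diamond_cactus_cut_vertices[of n W F, OF cyc one dist n] by blast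
  have "\<forall>i. \<exists>p q. i < n \<longrightarrow> distinct [c i, p, c (Suc i), q] \<and> W (Suc i) = {c i, p, c (Suc i), q} \<and>
     F (Suc i) = {{c i, p}, {p, c (Suc i)}, {c (Suc i), q}, {q, c i}}"
    using opp unfolding opposite_def by blast
  then obtain p q where
      dst: "\<And>i. i < n \<Longrightarrow> distinct [c i, p i, c (Suc i), q i]"
    and W: "\<And>i. i < n \<Longrightarrow> W (Suc i) = {c i, p i, c (Suc i), q i}"
    and F: "\<And>i. i < n \<Longrightarrow> F (Suc i) = {{c i, p i}, {p i, c (Suc i)}, {c (Suc i), q i}, {q i, c i}}"
    by metis
  have common: "j = Suc i \<and> x = c j" if "i < j" "j < n" "x \<in> W (Suc i)" "x \<in> W (Suc j)" for i j x
  proof -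
    have "j = Suc i"
      using disj[rule_format, of "Suc i" "Suc j"] that by fastforce
    with cut[of j] that show ?thesis by auto
  qed
  have inner: "i = j" if "i < n" "j < n" "x = p i \<or> x = q i" "x \<in> W (Suc j)" for i j x
  proof (rule ccontr)
    have x: "x \<in> W (Suc i)" "x \<noteq> c i" "x \<noteq> c (Suc i)"
      using that W[of i] dst[of i] by auto
    assume "i \<noteq> j"
    then consider "i < j" | "j < i" by linarith
    then show False
      by cases (use common[of i j x] common[of j i x] x that in auto)
  qed
  have c_less: "c i \<noteq> c j" if "i < j" "j \<le> n" for i j
  proof
    assume eq: "c i = c j"
    have ci: "c i \<in> W (Suc i)" using W[of i] that by auto
    obtain k where k: "j = Suc k" using \<open>i < j\<close> by (cases j) auto
    have cj: "c i \<in> W (Suc k)" using W[of k] that k eq by auto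
    have "i \<noteq> k" using dst[of i] that k eq by auto
    then have "i < k" using that k by simp
    then have "k = Suc i" "c i = c k" using common[of i k] ci cj that k by auto
    then show False using dst[of i] that k by auto
  qed
  have c_mem: "\<exists>k<n. c j \<in> W (Suc k) \<and> (j = k \<or> j = Suc k)" if "j \<le> n" for j
  proof (cases "j < n")
    case True
    then show ?thesis using W[of j] by auto
  next
    case False
    then have "j = Suc (n - 1)" "n - 1 < n" using that n by auto
    then show ?thesis using W[of "n - 1"] by auto
  qed
  have inner_neq_c: "p i \<noteq> c j \<and> q i \<noteq> c j" if "i < n" "j \<le> n" for i j
  proof -
    obtain k where k: "k < n" "c j \<in> W (Suc k)" "j = k \<or> j = Suc k"
      using c_mem[OF \<open>j \<le> n\<close>] by blast
    have "i = k" if "c j = p i \<or> c j = q i"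
      using inner[OF \<open>i < n\<close> k(1) that k(2)] .
    with k(3) dst[OF \<open>i < n\<close>] show ?thesis
      by force
  qed
  have chain: "diamond_chain n c p q"
  proof
    show "c i = c j \<longleftrightarrow> i = j" if "i \<le> n" "j \<le> n" for i j
      using c_less[of i j] c_less[of j i] that by (metis nat_neq_iff)
    show "p i = p j \<longleftrightarrow> i = j" if "i < n" "j < n" for i j
      using inner[of i j "p i"] W[of j] that by auto
    show "q i = q j \<longleftrightarrow> i = j" if "i < n" "j < n" for i j
      using inner[of i j "q i"] W[of j] that by auto
    show "p i \<noteq> q j" if "i < n" "j < n" for i j
      using inner[of i j "p i"] W[of j] dst[of i] that by auto
    show "p i \<noteq> c j" if "i < n" "j \<le> n" for i j
      using inner_neq_c that by blast
    show "q i \<noteq> c j" if "i < n" "j \<le> n" for i j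
      using inner_neq_c that by blast
  qed
  have idx: "{1..n} = Suc ` {..<n}"
    by (simp add: image_Suc_lessThan)
  have "V = (\<Union>i<n. W (Suc i))"
    unfolding V idx by simp
  also have "\<dots> = diamond_chain.verts n c p q"
    unfolding diamond_chain.verts_def[OF chain]
  proof (intro equalityI subsetI)
    fix x assume "x \<in> c ` {..n} \<union> p ` {..<n} \<union> q ` {..<n}"
    then show "x \<in> (\<Union>i<n. W (Suc i))"
      using c_mem W by fastforce
  qed (use W in fastforce)
  finally have V': "V = diamond_chain.verts n c p q" .
  have "E = diamond_chain.edges n c p q"
    unfolding E idx diamond_chain.edges_def[OF chain] using F by simp
  with chain V' show ?thesis
    by (rule that)
qed

lemma num_maximal_independent_diamond_cactus:
  assumes "diamond_cactus n V E"
  shows "num_maximal_independent V E = num_words False (Suc n)"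
  using assms
  by (elim diamond_cactus_labelling) (simp add: diamond_chain.num_maximal_independent_chain)

theorem theorem2p5:
  fixes V :: "nat \<Rightarrow> 'a set" and E :: "nat \<Rightarrow> 'a set set" and d :: "nat \<Rightarrow> nat"
  assumes D: "\<And>n. n \<ge> 1 \<Longrightarrow> diamond_cactus n (V n) (E n)"
    and d: "\<And>n. n \<ge> 1 \<Longrightarrow> d n = num_maximal_independent (V n) (E n)"
  shows "d 1 = 2 \<and> d 2 = 4 \<and> d 3 = 7 \<and>
    (\<forall>n\<ge>4. int (d n) = 2 * int (d (n - 1)) - int (d (n - 2)) + int (d (n - 3)))"
proof -
  have dn: "d n = num_words False (Suc n)" if "n \<ge> 1" for n
    using d[OF that] num_maximal_independent_diamond_cactus[OF D[OF that]] by simp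
  have "d 1 = 2" "d 2 = 4" "d 3 = 7"
    by (simp_all add: dn eval_nat_numeral num_words_False_1 num_words_False_Suc_Suc num_words_True_Suc)
  moreover have "int (d n) = 2 * int (d (n - 1)) - int (d (n - 2)) + int (d (n - 3))" if "n \<ge> 4" for n
  proof -
    obtain m where n: "n = m + 4"
      using \<open>n \<ge> 4\<close> by (metis le_add_diff_inverse2)
    show ?thesis
      using num_words_recurrence[of "Suc m"] by (simp add: n dn eval_nat_numeral)
  qed
  ultimately show ?thesis by blast
qed

end
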